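(* For every $n\ge1$, $|\operatorname{Sort}_n(\operatorname{SC}_{123})|=M_{n+1}-M_n$.
   Context: $S_n$ is the set of permutations of $[n]$ in one-line notation. Two sequences of distinct integers have the same relative order if replacing the $i$th smallest entry of each by $i$ yields the same word; a permutation contains $\sigma$ classically (resp. consecutively) if some subsequence (resp. consecutive subsequence) has the same relative order as $\sigma$, and avoids it otherwise. $\operatorname{SC}_{123}:S_n\to S_n$ sends a permutation through a stack: at each step, if there is a next input entry and placing it on top of the stack would make the stack contents, read top to bottom, avoid $123$ consecutively, push it; otherwise pop the top entry to the end of the output; stop when the output has length $n$. $\operatorname{Sort}_n(\operatorname{SC}_{123})$ is the set of $\pi\in S_n$ with $\operatorname{SC}_{123}(\pi)$ avoiding $231$ classically. Motzkin numbers: $M_0=M_1=1$ and $M_n=M_{n-1}+\sum_{i=0}^{n-2}M_iM_{n-2-i}$ for $n\ge2$. *)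

theory Defs
  imports
    "HOL-Combinatorics.Multiset_Permutations"
    "HOL-Library.Sublist"
    "HOL-Library.While_Combinator"
begin

definition perms :: "nat \<Rightarrow> nat list set" where
  "perms n = permutations_of_set {1..n}"

(* The i-th smallest entry is replaced by i (1-based); intended for lists with distinct entries. *)
definition standardize :: "nat list \<Rightarrow> nat list" where
  "standardize xs = map (\<lambda>x. card {y \<in> set xs. y \<le> x}) xs"

definition same_relative_order :: "nat list \<Rightarrow> nat list \<Rightarrow> bool" where
  "same_relative_order xs ys \<longleftrightarrow> standardize xs = standardize ys"

definition contains_classically :: "nat list \<Rightarrow> nat list \<Rightarrow> bool" where
  "contains_classically \<sigma> p \<longleftrightarrow> (\<exists>q. subseq q p \<and> same_relative_order q \<sigma>)"

definition contains_consecutively :: "nat list \<Rightarrow> nat list \<Rightarrow> bool" where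
  "contains_consecutively \<sigma> p \<longleftrightarrow> (\<exists>q. sublist q p \<and> same_relative_order q \<sigma>)"

(* States are (remaining input, stack, output); the head of the stack list is the top of the stack. *)
definition sc_step ::
  "nat list \<Rightarrow> nat list \<times> nat list \<times> nat list \<Rightarrow> nat list \<times> nat list \<times> nat list" where
  "sc_step \<sigma> = (\<lambda>(inp, st, out).
     if inp \<noteq> [] \<and> \<not> contains_consecutively \<sigma> (hd inp # st)
     then (tl inp, hd inp # st, out)
     else (inp, tl st, out @ [hd st]))"

(* For patterns of length at least 2 the stack is never popped while empty and the loop terminates. *)
definition SC :: "nat list \<Rightarrow> nat list \<Rightarrow> nat list" where
  "SC \<sigma> p =
     (case while (\<lambda>(inp, st, out). length out < length p) (sc_step \<sigma>) (p, [], []) of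
        (inp, st, out) \<Rightarrow> out)"

definition Sort :: "nat \<Rightarrow> (nat list \<Rightarrow> nat list) \<Rightarrow> nat list set" where
  "Sort n f = {p \<in> perms n. \<not> contains_classically [2, 3, 1] (f p)}"

fun motzkin :: "nat \<Rightarrow> nat" where
  "motzkin 0 = 1"
| "motzkin (Suc 0) = 1"
| "motzkin (Suc (Suc n)) = motzkin (Suc n) + (\<Sum>i\<le>n. motzkin i * motzkin (n - i))"

end

theory Submission
  imports Defs
begin

text \<open>
  A push is refused exactly when it would continue a descending run of the input beyond length
  two, and then the middle entry is popped. Hence the output consists of the interior entries of
  all descending runs, in input order, followed by the first and last entries of the runs in
  reverse order. It avoids 231 iff the input avoids 132 and the middle entry of every double
  descent exceeds everything after it, i.e. is a skew component on its own.

  Writing a 132-avoiding permutation as \<open>L m R\<close> with maximum \<open>m\<close> and \<open>L\<close> above \<open>R\<close>, such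
  permutations correspond to pairs where \<open>L\<close> has no double descent, and where \<open>m R\<close> has
  again only double descents of the above kind. Both factors are counted by Motzkin numbers, so
  the total is their convolution, which is \<open>M\<^sub>n\<^sub>+\<^sub>1 - M\<^sub>n\<close> by the Motzkin recurrence.
\<close>

section \<open>Patterns of length three\<close>

text \<open>If \<open>x < y\<close>, then \<open>y\<close> itself is counted on the right only.
  Comparing ranks therefore recovers the order of the entries from a standardized word.\<close>

lemma rank_less_iff:
  fixes x y :: nat
  assumes "finite A" "y \<in> A"
  shows "card {z \<in> A. z \<le> x} < card {z \<in> A. z \<le> y} \<longleftrightarrow> x < y"
proof
  assume "x < y"
  then have "{z \<in> A. z \<le> x} \<subseteq> {z \<in> A. z \<le> y}" "y \<in> {z \<in> A. z \<le> y} - {z \<in> A. z \<le> x}"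
    using assms by auto
  then have "{z \<in> A. z \<le> x} \<subset> {z \<in> A. z \<le> y}" by blast
  then show "card {z \<in> A. z \<le> x} < card {z \<in> A. z \<le> y}"
    using assms by (intro psubset_card_mono) auto
next
  assume less: "card {z \<in> A. z \<le> x} < card {z \<in> A. z \<le> y}"
  show "x < y"
  proof (rule ccontr)
    assume "\<not> x < y"
    then have "card {z \<in> A. z \<le> y} \<le> card {z \<in> A. z \<le> x}"
      using assms by (intro card_mono) auto
    with less show False by simp
  qed
qed

lemma rank_increasing:
  assumes "a < b" "b < c"
  shows "card {y \<in> {a, b, c}. y \<le> a} = (1::nat)"
    "card {y \<in> {a, b, c}. y \<le> b} = (2::nat)"
    "card {y \<in> {a, b, c :: nat}. y \<le> c} = (3::nat)"
proof -
  have "{y \<in> {a, b, c}. y \<le> a} = {a}" "{y \<in> {a, b, c}. y \<le> b} = {a, b}"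
    "{y \<in> {a, b, c}. y \<le> c} = {a, b, c}" using assms by auto
  then show "card {y \<in> {a, b, c}. y \<le> a} = (1::nat)"
    "card {y \<in> {a, b, c}. y \<le> b} = (2::nat)"
    "card {y \<in> {a, b, c :: nat}. y \<le> c} = (3::nat)" using assms by auto
qed

lemma standardize_123: "standardize [1, 2, 3] = [1, 2, 3]"
  using rank_increasing[of 1 2 3] by (simp add: standardize_def)

lemma standardize_231: "standardize [2, 3, 1] = [2, 3, 1]"
proof -
  have "{2, 3, 1} = {1, 2, 3::nat}" by auto
  then show ?thesis
    using rank_increasing[of 1 2 3] by (simp add: standardize_def)
qed

lemma length_standardize [simp]: "length (standardize xs) = length xs"
  by (simp add: standardize_def)

lemma same_relative_order_123_iff:
  "same_relative_order q [1, 2, 3] \<longleftrightarrow> (\<exists>a b c. q = [a, b, c] \<and> a < b \<and> b < c)"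
proof
  assume "same_relative_order q [1, 2, 3]"
  then have std: "standardize q = [1, 2, 3]"
    by (simp only: same_relative_order_def standardize_123)
  then have "length q = 3" by (metis length_standardize length_Cons list.size(3) numeral_3_eq_3)
  then obtain a b c where q: "q = [a, b, c]"
    by (auto simp: numeral_3_eq_3 length_Suc_conv)
  let ?rank = "\<lambda>x. card {y \<in> {a, b, c}. y \<le> x}"
  have "?rank a = 1" "?rank b = 2" "?rank c = 3"
    using std unfolding q by (auto simp: standardize_def)
  then have "?rank a < ?rank b" "?rank b < ?rank c" by linarith+
  then have "a < b \<and> b < c" by (subst (asm) (1 2) rank_less_iff) auto
  with q show "\<exists>a b c. q = [a, b, c] \<and> a < b \<and> b < c" by blast
next
  assume "\<exists>a b c. q = [a, b, c] \<and> a < b \<and> b < c"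
  then obtain a b c where "q = [a, b, c]" "a < b" "b < c" by blast
  then show "same_relative_order q [1, 2, 3]"
    using rank_increasing[of a b c]
    unfolding same_relative_order_def standardize_123 by (simp add: standardize_def)
qed

lemma same_relative_order_231_iff:
  "same_relative_order q [2, 3, 1] \<longleftrightarrow> (\<exists>a b c. q = [b, c, a] \<and> a < b \<and> b < c)"
proof
  assume "same_relative_order q [2, 3, 1]"
  then have std: "standardize q = [2, 3, 1]"
    by (simp only: same_relative_order_def standardize_231)
  then have "length q = 3" by (metis length_standardize length_Cons list.size(3) numeral_3_eq_3)
  then obtain a b c where q: "q = [b, c, a]"
    by (auto simp: numeral_3_eq_3 length_Suc_conv)
  let ?rank = "\<lambda>x. card {y \<in> {b, c, a}. y \<le> x}"
  have "?rank a = 1" "?rank b = 2" "?rank c = 3"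
    using std unfolding q by (auto simp: standardize_def)
  then have "?rank a < ?rank b" "?rank b < ?rank c" by linarith+
  then have "a < b \<and> b < c" by (subst (asm) (1 2) rank_less_iff) auto
  with q show "\<exists>a b c. q = [b, c, a] \<and> a < b \<and> b < c" by blast
next
  assume "\<exists>a b c. q = [b, c, a] \<and> a < b \<and> b < c"
  then obtain a b c where q: "q = [b, c, a]" "a < b" "b < c" by blast
  have "{b, c, a} = {a, b, c}" by auto
  with q show "same_relative_order q [2, 3, 1]"
    using rank_increasing[of a b c]
    unfolding same_relative_order_def standardize_231 by (simp add: standardize_def)
qed

text \<open>An occurrence either starts at the top or lies further down. As long as the stack avoids
  the pattern, the test before a push thus concerns only the incoming entry and the two topmost
  ones.\<close>

lemma contains_consecutively_123_Cons_Cons: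
  "contains_consecutively [1, 2, 3] (x # y # z # st) \<longleftrightarrow>
    x < y \<and> y < z \<or> contains_consecutively [1, 2, 3] (y # z # st)"
proof -
  have "prefix q (x # y # z # st) \<and> (\<exists>a b c. q = [a, b, c] \<and> a < b \<and> b < c) \<longleftrightarrow>
      q = [x, y, z] \<and> x < y \<and> y < z" for q
    by auto
  then show ?thesis
    unfolding contains_consecutively_def same_relative_order_123_iff sublist_Cons_right[of _ x]
    by blast
qed

lemma contains_consecutively_length:
  "contains_consecutively [1, 2, 3] st \<Longrightarrow> 3 \<le> length st"
  unfolding contains_consecutively_def same_relative_order_123_iff
  by (auto dest: sublist_length_le)

section \<open>Avoidance of 132 and, by reversal, of 231\<close>

fun av132 :: "nat list \<Rightarrow> bool" where
  "av132 [] = True"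
| "av132 (x # xs) = (sorted (filter (\<lambda>y. x < y) xs) \<and> av132 xs)"

lemma subseq_Cons_Cons:
  "subseq (y # ys) (x # xs) \<longleftrightarrow> y = x \<and> subseq ys xs \<or> subseq (y # ys) xs"
  by (auto simp: subseq_Cons2_iff dest: subseq_Cons')

lemma sorted_filter_iff_subseq:
  fixes xs :: "nat list"
  shows "sorted (filter P xs) \<longleftrightarrow> \<not> (\<exists>b c. subseq [c, b] xs \<and> P b \<and> P c \<and> b < c)"
proof (induction xs)
  case (Cons x xs)
  then show ?case
    by (cases "P x") (simp_all add: subseq_Cons_Cons subseq_singleton_left not_less del: subseq_Cons2_iff, blast+)
qed simp

text \<open>An occurrence of 132 either uses the first entry, as the smallest of the three, so that
  the larger entries after it are not sorted, or it lies in the tail.\<close>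

lemma av132_iff_subseq:
  "av132 xs \<longleftrightarrow> \<not> (\<exists>a b c. subseq [a, c, b] xs \<and> a < b \<and> b < c)"
proof (induction xs)
  case (Cons x xs)
  \<comment> \<open>With \<open>x < c\<close> made explicit, both later entries satisfy the
    predicate of the filter.\<close>
  have "x < b \<and> b < c \<longleftrightarrow> x < b \<and> x < c \<and> b < c" for b c by auto
  then have "(\<exists>a b c. subseq [a, c, b] (x # xs) \<and> a < b \<and> b < c) \<longleftrightarrow>
      (\<exists>b c. subseq [c, b] xs \<and> x < b \<and> x < c \<and> b < c) \<or>
      (\<exists>a b c. subseq [a, c, b] xs \<and> a < b \<and> b < c)"
    unfolding subseq_Cons_Cons[of _ _ x] by blast
  then show ?case by (simp only: av132.simps sorted_filter_iff_subseq Cons de_Morgan_disj)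
qed simp

lemma subseq_rev: "subseq xs ys \<Longrightarrow> subseq (rev xs) (rev ys)"
  by (induction rule: list_emb.induct) (auto intro: list_emb_append_mono)

lemma contains_classically_231_iff:
  "contains_classically [2, 3, 1] xs \<longleftrightarrow> \<not> av132 (rev xs)"
proof -
  have "subseq [b, c, a] xs \<longleftrightarrow> subseq [a, c, b] (rev xs)" for a b c
    using subseq_rev[of "[b, c, a]" xs] subseq_rev[of "[a, c, b]" "rev xs"] by auto
  then show ?thesis
    unfolding contains_classically_def same_relative_order_231_iff av132_iff_subseq by blast
qed

section \<open>The output of the stack\<close>

text \<open>The stack loop as a recursion on input and stack that returns only what is still to be
  output. It tests just the three topmost entries, which is faithful for stacks that avoid
  123.\<close>

function stack_output :: "nat list \<Rightarrow> nat list \<Rightarrow> nat list" where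
  "stack_output [] st = st"
| "stack_output (x # inp) [] = stack_output inp [x]"
| "stack_output (x # inp) [y] = stack_output inp [x, y]"
| "stack_output (x # inp) (y # z # st) =
    (if x < y \<and> y < z then y # stack_output (x # inp) (z # st)
     else stack_output inp (x # y # z # st))"
  by pat_completeness auto
text \<open>A push moves one entry from the input to the stack, so input entries must weigh more
  than stack entries.\<close>

termination by (relation "measure (\<lambda>(inp, st). 2 * length inp + length st)") auto

text \<open>Loop invariant: the stack avoids 123 consecutively and no entry gets lost. By the second
  part, the output reaches length \<open>n\<close> exactly when input and stack are both
  empty.\<close>

lemma while_sc_step:
  assumes "\<not> contains_consecutively [1, 2, 3] st"
    and "length inp + length st + length out = n"
  shows "while (\<lambda>(inp, st, out). length out < n) (sc_step [1, 2, 3]) (inp, st, out) =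
    ([], [], out @ stack_output inp st)"
  using assms
proof (induction inp st arbitrary: out rule: stack_output.induct)
  case (1 st)
  then show ?case
  proof (induction st arbitrary: out)
    case Nil
    then show ?case by (subst while_unfold) simp
  next
    case (Cons y st)
    have "\<not> contains_consecutively [1, 2, 3] st"
      using Cons.prems(1) unfolding contains_consecutively_def
      by (auto simp: sublist_Cons_right)
    then show ?case
      using Cons.prems Cons.IH[of "out @ [y]"] by (subst while_unfold) (simp add: sc_step_def)
  qed
next
  case (2 x inp)
  have "\<not> contains_consecutively [1, 2, 3] [x]"
    using contains_consecutively_length[of "[x]"] by auto
  then show ?case using 2 by (subst while_unfold) (simp add: sc_step_def)
next
  case (3 x inp y)
  have "\<not> contains_consecutively [1, 2, 3] [x, y]"
    using contains_consecutively_length[of "[x, y]"] by auto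
  then show ?case using 3 by (subst while_unfold) (simp add: sc_step_def)
next
  case (4 x inp y z st)
  show ?case
  proof (cases "x < y \<and> y < z")
    case True
    have "\<not> contains_consecutively [1, 2, 3] (z # st)"
      using "4.prems"(1) unfolding contains_consecutively_def
      by (auto simp: sublist_Cons_right)
    then show ?thesis
      using 4 True contains_consecutively_123_Cons_Cons[of x y z st]
      by (subst while_unfold) (simp add: sc_step_def)
  next
    case False
    then have "\<not> contains_consecutively [1, 2, 3] (x # y # z # st)"
      using 4 contains_consecutively_123_Cons_Cons[of x y z st] by blast
    then show ?thesis
      using "4.IH"(2)[OF False, of out] "4.prems" False
      by (subst while_unfold) (auto simp: sc_step_def)
  qed
qed

lemma SC_123_eq_stack_output: "SC [1, 2, 3] p = stack_output p []"
  unfolding SC_def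
  using contains_consecutively_length[of "[]"] by (subst while_sc_step) auto

text \<open>
  In a maximal descending run every entry except the first and the last is popped by its
  successor; the remaining entries stay on the stack until the input is exhausted.
\<close>

fun run_interiors :: "nat list \<Rightarrow> nat list" where
  "run_interiors (a # x # b # zs) =
    (if x < a \<and> b < x then x # run_interiors (a # b # zs) else run_interiors (x # b # zs))"
| "run_interiors _ = []"

text \<open>When the middle entry \<open>x\<close> is dropped, \<open>a\<close> stays at the head
  and is compared with \<open>b\<close> next, just as \<open>a\<close> resurfaces on the stack when
  \<open>x\<close> is popped.\<close>

fun run_ends :: "nat list \<Rightarrow> nat list" where
  "run_ends (a # x # b # zs) =
    (if x < a \<and> b < x then run_ends (a # b # zs) else a # run_ends (x # b # zs))"
| "run_ends xs = xs"

lemma stack_output_push: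
  assumes "case st of y # z # _ \<Rightarrow> \<not> (x < y \<and> y < z) | _ \<Rightarrow> True"
  shows "stack_output (x # inp) st = stack_output inp (x # st)"
  using assms by (cases "(x # inp, st)" rule: stack_output.cases) auto

text \<open>The first hypothesis lets the head of \<open>p\<close> be pushed onto \<open>st\<close>;
  the second keeps that head from being popped by its successor. Together they ensure that
  \<open>st\<close> stays untouched until the input is exhausted.\<close>

lemma stack_output_eq_runs:
  assumes "case st of y # z # _ \<Rightarrow> p \<noteq> [] \<longrightarrow> \<not> (hd p < y \<and> y < z) | _ \<Rightarrow> True"
    and "case st of y # _ \<Rightarrow> (case p of x # b # _ \<Rightarrow> \<not> (b < x \<and> x < y) | _ \<Rightarrow> True) | _ \<Rightarrow> True"
  shows "stack_output p st = run_interiors p @ rev (run_ends p) @ st"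
  using assms
proof (induction p arbitrary: st rule: run_ends.induct)
  case (1 a x b zs)
  have push: "stack_output (a # x # b # zs) st = stack_output (b # zs) (x # a # st)"
    using 1(3,4) by (auto simp: stack_output_push split: list.splits)
  show ?case
  proof (cases "x < a \<and> b < x")
    case True
    have "stack_output (a # x # b # zs) st = x # stack_output (b # zs) (a # st)"
      using push True by simp
    \<comment> \<open>Once \<open>x\<close> is popped, the state is the one reached from the input
      without \<open>x\<close>.\<close>
    also have "stack_output (b # zs) (a # st) = stack_output (a # b # zs) st"
      using 1(3) by (auto simp: stack_output_push split: list.splits)
    also have "\<dots> = run_interiors (a # b # zs) @ rev (run_ends (a # b # zs)) @ st"
      using 1(3,4) True by (intro 1(1)) (auto split: list.splits)
    finally show ?thesis using True by simp
  next
    case False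
    have "stack_output (a # x # b # zs) st = stack_output (x # b # zs) (a # st)"
      using 1(3) by (auto simp: stack_output_push split: list.splits)
    also have "\<dots> = run_interiors (x # b # zs) @ rev (run_ends (x # b # zs)) @ a # st"
      using 1(3,4) False by (intro 1(2)) (auto split: list.splits)
    finally show ?thesis using False by auto
  qed
next
  case "2_1"
  then show ?case by simp
next
  case ("2_2" v)
  then show ?case by (auto simp: stack_output_push split: list.splits)
next
  case ("2_3" v va)
  then show ?case by (auto simp: stack_output_push split: list.splits)
qed

section \<open>Characterisation of the sortable permutations\<close>

fun dominant_double_descents :: "nat list \<Rightarrow> bool" where
  "dominant_double_descents (a # x # b # zs) =
    ((x < a \<and> b < x \<longrightarrow> (\<forall>z\<in>set zs. z < x)) \<and> dominant_double_descents (x # b # zs))"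
| "dominant_double_descents _ = True"

lemma set_runs: "set (run_ends p) \<union> set (run_interiors p) = set p"
  by (induction p rule: run_ends.induct) auto

lemma mset_runs: "mset (run_ends p) + mset (run_interiors p) = mset p"
  by (induction p rule: run_ends.induct) (auto simp: add_ac)

lemma run_ends_eq_Cons: "\<exists>es. run_ends (x # xs) = x # es"
  by (induction "x # xs" arbitrary: x xs rule: run_ends.induct) auto

lemma sorted_wrtI: "(\<And>y z. y \<in> set w \<Longrightarrow> z \<in> set w \<Longrightarrow> R y z) \<Longrightarrow> sorted_wrt R w"
  by (induction w) auto

text \<open>A last entry can only play the role of the 2 in an occurrence of 132.\<close>

lemma av132_snoc:
  "av132 (v @ [x]) \<longleftrightarrow> av132 v \<and> sorted_wrt (\<lambda>y z. \<not> (y < x \<and> x < z)) v"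
  by (induction v) (auto simp: sorted_append not_less)

text \<open>Only interiors of runs move. An interior above \<open>a\<close> comes after the larger
  first entry of its run in both arrangements, so neither filtered list is sorted; any other
  interior is filtered out.\<close>

lemma sorted_filter_runs_iff:
  "sorted (filter (\<lambda>y. a < y) (run_ends p @ rev (run_interiors p))) \<longleftrightarrow>
    sorted (filter (\<lambda>y. a < y) p)"
proof (induction p rule: run_ends.induct)
  case (1 a' x b zs)
  show ?case
  proof (cases "x < a' \<and> b < x")
    case True
    obtain es where es: "run_ends (a' # b # zs) = a' # es" using run_ends_eq_Cons by blast
    show ?thesis
    proof (cases "a < x")
      case True
      then show ?thesis using es \<open>x < a' \<and> b < x\<close> by auto
    next
      case False
      then show ?thesis using True 1(1) by simp
    qed
  next
    case False
    define v where "v = run_ends (x # b # zs) @ rev (run_interiors (x # b # zs))"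
    have set_v: "set v = set (x # b # zs)" unfolding v_def set_append set_rev by (rule set_runs)
    have "run_ends (a' # x # b # zs) @ rev (run_interiors (a' # x # b # zs)) = a' # v"
      by (simp only: v_def run_ends.simps(1)[of a' x b zs] run_interiors.simps(1)[of a' x b zs]
          False if_False append_Cons)
    moreover have "sorted (filter (\<lambda>y. a < y) v) \<longleftrightarrow> sorted (filter (\<lambda>y. a < y) (x # b # zs))"
      unfolding v_def by (rule 1(2)[OF False])
    \<comment> \<open>The condition on the head depends only on the set of the entries after it,
      which the rearrangement preserves.\<close>
    moreover have "sorted (filter (\<lambda>y. a < y) (a' # ws)) \<longleftrightarrow>
        (a < a' \<longrightarrow> (\<forall>y\<in>set ws. a < y \<longrightarrow> a' \<le> y)) \<and> sorted (filter (\<lambda>y. a < y) ws)" for ws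
      by auto
    ultimately show ?thesis by (simp only: set_v)
  qed
qed auto

text \<open>
  That the middle \<open>x\<close> of a double descent is smaller than everything before it already
  follows from avoiding 132, so only the entries after \<open>x\<close> have to be compared with it.
\<close>

lemma av132_runs_iff:
  assumes "distinct p"
  shows "av132 (run_ends p @ rev (run_interiors p)) \<longleftrightarrow> av132 p \<and> dominant_double_descents p"
  using assms
proof (induction p rule: run_ends.induct)
  case (1 a x b zs)
  show ?case
  proof (cases "x < a \<and> b < x")
    case True
    let ?v = "run_ends (a # b # zs) @ rev (run_interiors (a # b # zs))"
    let ?sep = "sorted_wrt (\<lambda>y z. \<not> (y < x \<and> x < z)) ?v"
    have set_v: "set ?v = set (a # b # zs)" using set_runs[of "a # b # zs"] by simp
    obtain es where es: "run_ends (a # b # zs) = a # es" using run_ends_eq_Cons by blast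
    \<comment> \<open>As the first interior, \<open>x\<close> becomes the last entry once the
      interiors are reversed.\<close>
    have "av132 (run_ends (a # x # b # zs) @ rev (run_interiors (a # x # b # zs))) \<longleftrightarrow>
        av132 ?v \<and> ?sep"
      using True av132_snoc[of ?v x] by simp
    also have "\<dots> \<longleftrightarrow> av132 (a # b # zs) \<and> dominant_double_descents (a # b # zs) \<and> ?sep"
      using 1 True by simp
    also have "\<dots> \<longleftrightarrow> av132 (a # b # zs) \<and> dominant_double_descents (a # b # zs) \<and> (\<forall>z\<in>set zs. z < x)"
    proof -
      \<comment> \<open>Here \<open>a\<close> is the only entry of \<open>?v\<close> above
        \<open>x\<close>, and it comes first.\<close>
      have "?sep" if "\<forall>z\<in>set zs. z < x"
      proof -
        let ?w = "es @ rev (run_interiors (a # b # zs))"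
        have v: "?v = a # ?w" using es by simp
        have "mset ?v = mset (a # b # zs)" using mset_runs[of "a # b # zs"] by simp
        then have "distinct ?v \<longleftrightarrow> distinct (a # b # zs)" by (rule mset_eq_imp_distinct_iff)
        also have "distinct (a # b # zs)" using 1(3) by simp
        finally have "distinct ?v" by blast
        then have "a \<notin> set ?w" unfolding v by simp
        moreover have "set ?w \<subseteq> set (a # b # zs)" using set_v unfolding v by auto
        ultimately have "\<forall>z\<in>set ?w. z < x" using that True by auto
        then have "sorted_wrt (\<lambda>y z. \<not> (y < x \<and> x < z)) ?w"
          by (intro sorted_wrtI) (auto simp only: less_asym)
        then show ?thesis unfolding v using True by auto
      qed
      \<comment> \<open>If \<open>zs\<close> starts with a \<open>c\<close> below \<open>b\<close>,
        then \<open>a, b, c\<close> is a double descent, and its dominance bounds the rest by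
        \<open>b < x\<close>. Otherwise \<open>b\<close> is not interior and stands directly after
        \<open>a\<close> in \<open>?v\<close>; since \<open>b < x\<close>, nothing after it may
        exceed \<open>x\<close>.\<close>
      moreover have "\<forall>z\<in>set zs. z < x" if "dominant_double_descents (a # b # zs)" "?sep"
      proof (cases zs)
        case (Cons c ws)
        show ?thesis
        proof (cases "c < b")
          case True
          then show ?thesis using that(1) \<open>x < a \<and> b < x\<close> Cons by auto
        next
          case False
          obtain es' where "run_ends (b # zs) = b # es'" using run_ends_eq_Cons by blast
          then have v: "?v = a # b # es' @ rev (run_interiors (a # b # zs))"
            using False Cons by simp
          show ?thesis
          proof
            fix z
            assume z: "z \<in> set zs"
            then have "z \<in> set ?v" "z \<noteq> a" "z \<noteq> b" "z \<noteq> x" using set_v 1(3) by auto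
            then have "z \<in> set (es' @ rev (run_interiors (a # b # zs)))" unfolding v by simp
            then have "\<not> (b < x \<and> x < z)" using that(2) unfolding v by auto
            then show "z < x" using True \<open>z \<noteq> x\<close> by simp
          qed
        qed
      qed simp
      ultimately show ?thesis by blast
    qed
    also have "\<dots> \<longleftrightarrow> av132 (a # x # b # zs) \<and> dominant_double_descents (a # x # b # zs)"
    proof -
      have "filter (\<lambda>y. a < y) zs = []" "filter (\<lambda>y. x < y) zs = []" if "\<forall>z\<in>set zs. z < x"
        using that True by (auto simp: filter_empty_conv)
      \<comment> \<open>Both \<open>a\<close> and \<open>x\<close> exceed \<open>b\<close>, and the
        condition on a triple reads its first entry only through this comparison.\<close>
      moreover have "dominant_double_descents (a # b # zs) \<longleftrightarrow> dominant_double_descents (x # b # zs)"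
        using True by (cases zs) auto
      ultimately show ?thesis
        using True by (cases "\<forall>z\<in>set zs. z < x") (simp_all del: dominant_double_descents.simps
            add: dominant_double_descents.simps(1)[of a x], blast)
    qed
    finally show ?thesis .
  next
    case False
    let ?v = "run_ends (x # b # zs) @ rev (run_interiors (x # b # zs))"
    have "av132 (run_ends (a # x # b # zs) @ rev (run_interiors (a # x # b # zs))) \<longleftrightarrow> av132 (a # ?v)"
      by (simp only: run_ends.simps(1)[of a x b zs] run_interiors.simps(1)[of a x b zs]
          False if_False append_Cons)
    also have "\<dots> \<longleftrightarrow> sorted (filter (\<lambda>y. a < y) (x # b # zs)) \<and> av132 ?v"
      by (simp only: av132.simps sorted_filter_runs_iff)
    also have "av132 ?v \<longleftrightarrow> av132 (x # b # zs) \<and> dominant_double_descents (x # b # zs)"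
      using 1(3) by (intro 1(2)[OF False]) simp
    finally show ?thesis
      using False by (simp only: av132.simps(2)[of a] dominant_double_descents.simps) blast
  qed
qed auto

text \<open>Reversal turns 231 into 132 and the output into the arrangement treated by
  \<open>av132_runs_iff\<close>.\<close>

lemma Sort_SC_123_eq:
  "Sort n (SC [1, 2, 3]) = {p \<in> perms n. av132 p \<and> dominant_double_descents p}"
proof -
  have "\<not> contains_classically [2, 3, 1] (SC [1, 2, 3] p) \<longleftrightarrow> av132 p \<and> dominant_double_descents p"
    if "p \<in> perms n" for p
  proof -
    have "distinct p" using that by (simp add: perms_def permutations_of_set_def)
    moreover have "SC [1, 2, 3] p = run_interiors p @ rev (run_ends p)"
      unfolding SC_123_eq_stack_output by (subst stack_output_eq_runs) simp_all
    ultimately show ?thesis unfolding contains_classically_231_iff by (simp add: av132_runs_iff)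
  qed
  then show ?thesis unfolding Sort_def by blast
qed

section \<open>Splitting at the maximum\<close>

fun no_double_descent :: "nat list \<Rightarrow> bool" where
  "no_double_descent (a # x # b # zs) = (\<not> (x < a \<and> b < x) \<and> no_double_descent (x # b # zs))"
| "no_double_descent _ = True"

text \<open>The condition on \<open>R\<close> coming from the triple at the front of
  \<open>m # R\<close> when \<open>m\<close> is the maximum. \<open>dominant_initial_descent\<close>
  is its analogue for double descents that are allowed if dominant.\<close>

fun no_initial_descent :: "nat list \<Rightarrow> bool" where
  "no_initial_descent (x # b # zs) = (\<not> b < x)"
| "no_initial_descent _ = True"

fun dominant_initial_descent :: "nat list \<Rightarrow> bool" where
  "dominant_initial_descent (x # b # zs) = (b < x \<longrightarrow> (\<forall>z\<in>set zs. z < x))"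
| "dominant_initial_descent _ = True"

text \<open>An entry of \<open>L\<close> below an entry of \<open>R\<close> would form 132 with
  \<open>m\<close> between them. If \<open>L\<close> lies above \<open>R\<close>, no occurrence can
  use entries of both, nor can it use \<open>m\<close>.\<close>

lemma av132_split:
  assumes "distinct (L @ m # R)" "\<forall>x\<in>set L \<union> set R. x < m"
  shows "av132 (L @ m # R) \<longleftrightarrow> (\<forall>x\<in>set L. \<forall>y\<in>set R. y < x) \<and> av132 L \<and> av132 R"
  using assms
proof (induction L)
  case Nil
  then have "filter (\<lambda>y. m < y) R = []" by (auto simp: filter_empty_conv)
  then show ?case by simp
next
  case (Cons x L)
  have le: "y < x \<longleftrightarrow> \<not> x < y" if "y \<in> set R" for y using that Cons.prems(1) by auto
  have "sorted (filter (\<lambda>y. x < y) (L @ m # R)) \<longleftrightarrow>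
      sorted (filter (\<lambda>y. x < y) L) \<and> (\<forall>y\<in>set R. y < x)"
  proof
    assume "sorted (filter (\<lambda>y. x < y) (L @ m # R))"
    then have "sorted (filter (\<lambda>y. x < y) L)" "\<forall>y\<in>set R. x < y \<longrightarrow> m \<le> y"
      using Cons.prems(2) by (auto simp: sorted_append)
    moreover have "\<forall>y\<in>set R. \<not> m \<le> y" using Cons.prems(2) by (simp add: not_le)
    ultimately show "sorted (filter (\<lambda>y. x < y) L) \<and> (\<forall>y\<in>set R. y < x)"
      using le by blast
  next
    assume *: "sorted (filter (\<lambda>y. x < y) L) \<and> (\<forall>y\<in>set R. y < x)"
    then have "filter (\<lambda>y. x < y) R = []" by (auto simp: filter_empty_conv)
    then show "sorted (filter (\<lambda>y. x < y) (L @ m # R))"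
      using * Cons.prems(2) by (auto simp: sorted_append less_imp_le)
  qed
  moreover have "av132 (L @ m # R) \<longleftrightarrow> (\<forall>x\<in>set L. \<forall>y\<in>set R. y < x) \<and> av132 L \<and> av132 R"
    using Cons by simp
  ultimately show ?case by auto
qed

text \<open>The maximum can only be the first entry of a double descent, so none of them reaches
  across it from \<open>L\<close>.\<close>

lemma no_double_descent_split:
  assumes "\<forall>x\<in>set L \<union> set R. x < m"
  shows "no_double_descent (L @ m # R) \<longleftrightarrow>
    no_double_descent L \<and> no_initial_descent R \<and> no_double_descent R"
  using assms
proof (induction L rule: no_double_descent.induct)
  case "2_1"
  then show ?case by (cases R rule: no_double_descent.cases) auto
next
  case ("2_2" v)
  then show ?case by (cases R rule: no_double_descent.cases) auto
next
  case ("2_3" v w)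
  then show ?case by (cases R rule: no_double_descent.cases) auto
qed auto

text \<open>A double descent inside \<open>L\<close> is followed by the maximum and hence never
  dominant, so \<open>L\<close> must have none.\<close>

lemma dominant_double_descents_split:
  assumes "\<forall>x\<in>set L \<union> set R. x < m"
  shows "dominant_double_descents (L @ m # R) \<longleftrightarrow>
    no_double_descent L \<and> dominant_initial_descent R \<and> dominant_double_descents R"
  using assms
proof (induction L rule: no_double_descent.induct)
  case (1 a x b zs)
  then have "\<not> (\<forall>z\<in>set (zs @ m # R). z < x)" by auto
  with 1 show ?case by auto
next
  case "2_1"
  then show ?case by (cases R rule: no_double_descent.cases) auto
next
  case ("2_2" v)
  then show ?case by (cases R rule: no_double_descent.cases) auto
next
  case ("2_3" v w)
  then show ?case by (cases R rule: no_double_descent.cases) auto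
qed

text \<open>An initial descent inside \<open>L\<close> is followed by \<open>m\<close> and so is not
  dominant. If \<open>L\<close> has at most one entry, the list either starts with \<open>m\<close>,
  which dominates \<open>R\<close>, or ascends to \<open>m\<close>.\<close>

lemma dominant_initial_descent_split:
  assumes "\<forall>x\<in>set L \<union> set R. x < m"
  shows "dominant_initial_descent (L @ m # R) \<longleftrightarrow> no_initial_descent L"
proof (cases L rule: no_initial_descent.cases)
  case (1 x b zs)
  then have "\<not> m < x" using assms by auto
  then show ?thesis using 1 by auto
next
  case "2_1"
  then show ?thesis using assms by (cases R) auto
next
  case ("2_2" v)
  then show ?thesis using assms by auto
qed

text \<open>If \<open>L\<close> is empty, the list starts with its maximum, which is a descent
  unless \<open>R\<close> is empty as well.\<close>

lemma no_initial_descent_split: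
  assumes "\<forall>x\<in>set L \<union> set R. x < m"
  shows "no_initial_descent (L @ m # R) \<longleftrightarrow> no_initial_descent L \<and> (L = [] \<longrightarrow> R = [])"
proof (cases L rule: no_initial_descent.cases)
  case "2_1"
  then show ?thesis using assms by (cases R) auto
next
  case ("2_2" v)
  then show ?thesis using assms by auto
qed auto

section \<open>Counting\<close>

text \<open>The free offset \<open>c\<close> lets both parts of a split keep their values instead of
  being standardized; the counts below do not depend on it.\<close>

definition interval_lists :: "(nat list \<Rightarrow> bool) \<Rightarrow> nat \<Rightarrow> nat \<Rightarrow> nat list set" where
  "interval_lists P c n = {xs. distinct xs \<and> set xs = {c..<c + n} \<and> P xs}"

lemma finite_interval_lists [simp]: "finite (interval_lists P c n)"
proof -
  have "finite {xs. set xs \<subseteq> {c..<c + n} \<and> distinct xs}" by (rule finite_subset_distinct) simp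
  then show ?thesis by (rule rev_finite_subset) (auto simp: interval_lists_def)
qed

lemma length_interval_lists: "xs \<in> interval_lists P c n \<Longrightarrow> length xs = n"
  using distinct_card[of xs] by (simp add: interval_lists_def)

lemma card_interval_lists_0: "card (interval_lists P c 0) = (if P [] then 1 else 0)"
proof -
  have "interval_lists P c 0 = (if P [] then {[]} else {})" by (auto simp: interval_lists_def)
  then show ?thesis by simp
qed

text \<open>No point of \<open>A\<close> lies below a point of \<open>B\<close>, so \<open>B\<close>
  is closed downwards in the interval and is its initial segment up to \<open>Max B\<close>.\<close>

lemma lower_part_of_interval:
  fixes A B :: "nat set"
  assumes "A \<union> B = {c..<c + n}" "\<forall>x\<in>A. \<forall>y\<in>B. y < x"
  shows "B = {c..<c + card B}" "A = {c + card B..<c + n}"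
proof -
  have fin: "finite B" using assms(1) by (metis finite_Un finite_atLeastLessThan)
  show B: "B = {c..<c + card B}"
  proof (cases "B = {}")
    case False
    have "B = {c..<Suc (Max B)}"
    proof
      show "B \<subseteq> {c..<Suc (Max B)}" using assms(1) fin by (auto simp: less_Suc_eq_le)
      have "Max B \<in> B" using fin False by simp
      show "{c..<Suc (Max B)} \<subseteq> B"
      proof
        fix y
        assume y: "y \<in> {c..<Suc (Max B)}"
        have "Max B \<in> {c..<c + n}" using \<open>Max B \<in> B\<close> assms(1) by blast
        then have "y \<in> A \<union> B" using assms(1) y by auto
        moreover have "y \<notin> A" using assms(2) \<open>Max B \<in> B\<close> y by fastforce
        ultimately show "y \<in> B" by blast
      qed
    qed
    moreover have "c \<le> Max B" using \<open>B = {c..<Suc (Max B)}\<close> False by auto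
    ultimately have "card B = Suc (Max B) - c" by (metis card_atLeastLessThan)
    then have "c + card B = Suc (Max B)" using \<open>c \<le> Max B\<close> by simp
    with \<open>B = {c..<Suc (Max B)}\<close> show ?thesis by simp
  qed simp
  have "A \<inter> B = {}" using assms(2) by blast
  then have "A = {c..<c + n} - B" using assms(1) by blast
  also have "\<dots> = {c..<c + n} - {c..<c + card B}" using B by simp
  also have "\<dots> = {c + card B..<c + n}" by auto
  finally show "A = {c + card B..<c + n}" .
qed

text \<open>
  The predicate \<open>Q\<close> also receives the number of entries other than the maximum, because the
  condition on the left factor may depend on whether the right factor is empty.
\<close>

lemma card_interval_lists_Suc:
  assumes split: "\<And>L m R. distinct (L @ m # R) \<Longrightarrow> \<forall>x\<in>set L \<union> set R. x < m \<Longrightarrow>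
    P (L @ m # R) \<longleftrightarrow>
      (\<forall>x\<in>set L. \<forall>y\<in>set R. y < x) \<and> Q (length L + length R) L \<and> S R"
  shows "card (interval_lists P c (Suc n)) =
    (\<Sum>i\<le>n. card (interval_lists (Q n) (c + (n - i)) i) * card (interval_lists S c (n - i)))"
proof -
  let ?f = "\<lambda>(L, R). L @ (c + n) # R"
  \<comment> \<open>\<open>i\<close> is the length of \<open>L\<close>, which takes the
    \<open>i\<close> largest values below the maximum \<open>c + n\<close>; \<open>R\<close> takes
    the \<open>n - i\<close> smallest.\<close>
  let ?D = "\<lambda>i. interval_lists (Q n) (c + (n - i)) i \<times> interval_lists S c (n - i)"
  have notin: "c + n \<notin> set L" "c + n \<notin> set R" "length L = i" if "(L, R) \<in> ?D i" "i \<le> n" for L R i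
    using that length_interval_lists[of L "Q n" "c + (n - i)" i] by (auto simp: interval_lists_def)
  have decomp: "interval_lists P c (Suc n) = (\<Union>i\<le>n. ?f ` ?D i)"
  proof (intro equalityI subsetI)
    fix xs
    assume "xs \<in> interval_lists P c (Suc n)"
    then have xs: "distinct xs" "set xs = {c..<Suc (c + n)}" "P xs"
      by (auto simp: interval_lists_def)
    then have "c + n \<in> set xs" by simp
    then obtain L R where LR: "xs = L @ (c + n) # R" by (meson split_list)
    have dist: "distinct L" "distinct R" "set L \<inter> set R = {}" "c + n \<notin> set L \<union> set R"
      using xs(1) LR by auto
    have un: "set L \<union> set R = {c..<c + n}"
    proof -
      have "set L \<union> set R = insert (c + n) (set L \<union> set R) - {c + n}"
        using dist(4) by blast
      also have "insert (c + n) (set L \<union> set R) = {c..<Suc (c + n)}"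
        unfolding xs(2)[symmetric] LR by simp
      also have "{c..<Suc (c + n)} - {c + n} = {c..<c + n}" by auto
      finally show ?thesis .
    qed
    have "\<forall>x\<in>set L \<union> set R. x < c + n" using un by simp
    then have "(\<forall>x\<in>set L. \<forall>y\<in>set R. y < x) \<and> Q (length L + length R) L \<and> S R"
      using split[of L "c + n" R] xs(1,3) unfolding LR by blast
    moreover have "length L + length R = n"
      using distinct_card[OF xs(1)] xs(2) LR by simp
    moreover have "card (set R) = length R" using dist distinct_card by blast
    ultimately have "(L, R) \<in> ?D (length L)" "length L \<le> n"
      using lower_part_of_interval[OF un] dist by (auto simp: interval_lists_def)
    then show "xs \<in> (\<Union>i\<le>n. ?f ` ?D i)" using LR by force
  next
    fix xs
    assume "xs \<in> (\<Union>i\<le>n. ?f ` ?D i)"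
    then obtain i L R where LR: "i \<le> n" "(L, R) \<in> ?D i" "xs = L @ (c + n) # R" by auto
    then have sets: "set L = {c + (n - i)..<c + n}" "set R = {c..<c + (n - i)}"
      "distinct L" "distinct R" "Q n L" "S R"
      by (auto simp: interval_lists_def)
    have len: "length L + length R = n"
      using LR by (auto dest!: length_interval_lists)
    have "distinct xs" using sets LR by auto
    moreover have "set xs = {c..<c + Suc n}" using sets LR by auto
    moreover have "P xs"
    proof -
      have "\<forall>x\<in>set L \<union> set R. x < c + n" "\<forall>x\<in>set L. \<forall>y\<in>set R. y < x"
        using sets by auto
      then show ?thesis
        using split[of L "c + n" R] \<open>distinct xs\<close> sets(5,6) len unfolding LR(3) by simp
    qed
    ultimately show "xs \<in> interval_lists P c (Suc n)" by (simp add: interval_lists_def)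
  qed
  have "card (interval_lists P c (Suc n)) = (\<Sum>i\<le>n. card (?f ` ?D i))"
    unfolding decomp
  proof (rule card_UN_disjoint)
    show "\<forall>i\<in>{..n}. \<forall>j\<in>{..n}. i \<noteq> j \<longrightarrow> ?f ` ?D i \<inter> ?f ` ?D j = {}"
    proof (intro ballI impI, rule ccontr)
      fix i j
      assume ij: "i \<in> {..n}" "j \<in> {..n}" "i \<noteq> j" and "?f ` ?D i \<inter> ?f ` ?D j \<noteq> {}"
      then obtain p q where pq: "p \<in> ?D i" "q \<in> ?D j" "?f p = ?f q" by blast
      obtain L R where p: "p = (L, R)" by (cases p)
      obtain L' R' where q: "q = (L', R')" by (cases q)
      have *: "(L, R) \<in> ?D i" "(L', R') \<in> ?D j" "L @ (c + n) # R = L' @ (c + n) # R'"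
        using pq unfolding p q by (simp_all only: prod.case)
      have le: "i \<le> n" "j \<le> n" using ij by simp_all
      \<comment> \<open>The maximum occurs only once, so cutting there determines
        \<open>L\<close>.\<close>
      have "L = L'"
        using *(3) append_Cons_eq_iff[OF notin(1,2)[OF *(1) le(1)]] by blast
      then show False using notin(3)[OF *(1) le(1)] notin(3)[OF *(2) le(2)] \<open>i \<noteq> j\<close> by simp
    qed
    show "\<forall>i\<in>{..n}. finite (?f ` ?D i)"
      by (intro ballI finite_imageI finite_cartesian_product finite_interval_lists)
  qed (rule finite_atMost)
  also have "\<dots> = (\<Sum>i\<le>n. card (?D i))"
  proof (rule sum.cong[OF refl])
    fix i
    assume "i \<in> {..n}"
    then have "i \<le> n" by simp
    have "inj_on ?f (?D i)"
    proof (rule inj_onI)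
      fix p q
      assume pq: "p \<in> ?D i" "q \<in> ?D i" "?f p = ?f q"
      obtain L R where p: "p = (L, R)" by (cases p)
      obtain L' R' where q: "q = (L', R')" by (cases q)
      have "L @ (c + n) # R = L' @ (c + n) # R'" using pq(3) unfolding p q by simp
      then have "L = L' \<and> R = R'"
        using append_Cons_eq_iff[OF notin(1,2)[OF pq(1)[unfolded p] \<open>i \<le> n\<close>]] by blast
      then show "p = q" unfolding p q by simp
    qed
    then show "card (?f ` ?D i) = card (?D i)" by (rule card_image)
  qed
  finally show ?thesis by (simp add: card_cartesian_product)
qed

text \<open>With M the Motzkin generating function, \<open>f\<close> has series 1 + zM, and the
  recurrence G = 1 + z(1 + zM)G is solved by G = M because M = 1 + zM + z*z*M*M. The map
  \<open>h\<close> only tracks offsets of intervals.\<close>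

lemma motzkin_convolution:
  assumes "f 0 = 1" "\<And>k. f (Suc k) = motzkin k"
    and "\<And>c. g c 0 = 1" "\<And>c n. g c (Suc n) = (\<Sum>i\<le>n. f i * g (h c i) (n - i))"
  shows "g c n = motzkin n"
proof (induction n arbitrary: c rule: less_induct)
  case (less n)
  show ?case
  proof (cases n rule: motzkin.cases)
    case 1
    then show ?thesis using assms by simp
  next
    case 2
    then show ?thesis using assms by simp
  next
    case (3 k)
    have "g c n = (\<Sum>i\<le>Suc k. f i * g (h c i) (Suc k - i))" using 3 assms(4) by simp
    \<comment> \<open>The summand \<open>i = 0\<close> becomes the linear term of the Motzkin
      recurrence, the others its convolution.\<close>
    also have "\<dots> = g (h c 0) (Suc k) + (\<Sum>i\<le>k. motzkin i * g (h c (Suc i)) (k - i))"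
      by (subst sum.atMost_Suc_shift) (simp add: assms)
    also have "\<dots> = motzkin (Suc k) + (\<Sum>i\<le>k. motzkin i * motzkin (k - i))"
      using less 3 by simp
    finally show ?thesis using 3 by simp
  qed
qed

text \<open>These are the lists that can follow a larger entry without creating a double descent.
  Both parts of a split are again of this kind, with \<open>L\<close> nonempty unless the maximum
  stands alone, which yields the Motzkin recurrence shifted by one.\<close>

lemma card_no_descent_av132:
  "card (interval_lists (\<lambda>xs. av132 xs \<and> no_double_descent xs \<and> no_initial_descent xs) c n) =
    (case n of 0 \<Rightarrow> 1 | Suc k \<Rightarrow> motzkin k)"
proof (induction n arbitrary: c rule: less_induct)
  case (less n)
  let ?P = "\<lambda>xs. av132 xs \<and> no_double_descent xs \<and> no_initial_descent xs"
  let ?b = "\<lambda>n. case n of 0 \<Rightarrow> 1 | Suc k \<Rightarrow> motzkin k"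
  \<comment> \<open>\<open>n\<close> counts the entries of both parts, so an empty \<open>L\<close>
    is allowed only if \<open>R\<close> is empty too.\<close>
  let ?Q = "\<lambda>n L. ?P L \<and> (L = [] \<longrightarrow> n = 0)"
  show ?case
  proof (cases n)
    case 0
    then show ?thesis by (simp add: card_interval_lists_0)
  next
    case (Suc m)
    have Q0: "card (interval_lists (?Q m) c' 0) = (if m = 0 then 1 else 0)" for c'
      by (simp add: card_interval_lists_0)
    have QSuc: "card (interval_lists (?Q m) c' (Suc i)) = motzkin i" if "Suc i \<le> m" for c' i
    proof -
      have "interval_lists (?Q m) c' (Suc i) = interval_lists ?P c' (Suc i)"
        by (auto simp: interval_lists_def)
      then show ?thesis using less[of "Suc i" c'] that Suc by simp
    qed
    have "card (interval_lists ?P c (Suc m)) =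
        (\<Sum>i\<le>m. card (interval_lists (?Q m) (c + (m - i)) i) * card (interval_lists ?P c (m - i)))"
      by (rule card_interval_lists_Suc)
        (auto simp: av132_split no_double_descent_split no_initial_descent_split)
    also have "\<dots> = motzkin m"
    proof (cases m rule: motzkin.cases)
      case 1
      then show ?thesis by (simp add: Q0[unfolded 1] card_interval_lists_0)
    next
      case 2
      then show ?thesis
        using Q0 QSuc[of 0] by (simp add: card_interval_lists_0)
    next
      case (3 k)
      \<comment> \<open>The summand \<open>i = 0\<close> vanishes because \<open>L\<close> must be
        nonempty here; the others shift down by one.\<close>
      have "(\<Sum>i\<le>m. card (interval_lists (?Q m) (c + (m - i)) i) * card (interval_lists ?P c (m - i)))
          = (\<Sum>i\<le>Suc k. motzkin i * ?b (Suc k - i))"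
        unfolding 3 sum.atMost_Suc_shift[of _ "Suc k"]
        using Q0 QSuc less Suc unfolding 3 by simp
      \<comment> \<open>The last summand, where \<open>R\<close> is empty, contributes the linear
        term.\<close>
      also have "\<dots> = motzkin (Suc k) + (\<Sum>i\<le>k. motzkin i * motzkin (k - i))"
        by (simp add: Suc_diff_le)
      finally show ?thesis using 3 by simp
    qed
    finally show ?thesis using Suc by simp
  qed
qed

text \<open>Here \<open>L\<close> is of the same kind and \<open>R\<close> of the restricted kind
  with series 1 + zM. The offset moves because \<open>L\<close> takes the upper values.\<close>

lemma card_no_double_descent_av132:
  "card (interval_lists (\<lambda>xs. av132 xs \<and> no_double_descent xs) c n) = motzkin n"
proof (rule motzkin_convolution[where h = "\<lambda>c i. c + i"
      and f = "\<lambda>n. case n of 0 \<Rightarrow> 1 | Suc k \<Rightarrow> motzkin k"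
      and g = "\<lambda>c n. card (interval_lists (\<lambda>xs. av132 xs \<and> no_double_descent xs) c n)"])
  let ?P = "\<lambda>xs. av132 xs \<and> no_double_descent xs"
  let ?S = "\<lambda>xs. av132 xs \<and> no_double_descent xs \<and> no_initial_descent xs"
  let ?b = "\<lambda>n. case n of 0 \<Rightarrow> 1 | Suc k \<Rightarrow> motzkin k"
  show "card (interval_lists ?P c (Suc n)) =
      (\<Sum>i\<le>n. ?b i * card (interval_lists ?P (c + i) (n - i)))" for c n
  proof -
    have "card (interval_lists ?P c (Suc n)) =
        (\<Sum>i\<le>n. card (interval_lists ?P (c + (n - i)) i) * card (interval_lists ?S c (n - i)))"
      by (rule card_interval_lists_Suc)
        (auto simp: av132_split no_double_descent_split)
    \<comment> \<open>Summing over the length of \<open>R\<close> instead of \<open>L\<close> gives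
      the shape of \<open>motzkin_convolution\<close>.\<close>
    also have "\<dots> = (\<Sum>i\<le>n. card (interval_lists ?P (c + (n - (n - i))) (n - i)) *
        card (interval_lists ?S c (n - (n - i))))"
      by (rule sum.reindex_bij_witness[of _ "\<lambda>i. n - i" "\<lambda>i. n - i"]) auto
    also have "\<dots> = (\<Sum>i\<le>n. ?b i * card (interval_lists ?P (c + i) (n - i)))"
      unfolding card_no_descent_av132 by (intro sum.cong) (auto simp: mult.commute)
    finally show ?thesis .
  qed
qed (auto simp: card_interval_lists_0)

text \<open>Now \<open>L\<close> is the restricted part, as a descent at its start would not be
  dominant, while \<open>R\<close> is of the same kind and keeps the offset
  \<open>c\<close>.\<close>

lemma card_dominant_descents_av132:
  "card (interval_lists
    (\<lambda>xs. av132 xs \<and> dominant_initial_descent xs \<and> dominant_double_descents xs) c n) = motzkin n"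
proof (rule motzkin_convolution[where h = "\<lambda>c i. c"
      and f = "\<lambda>n. case n of 0 \<Rightarrow> 1 | Suc k \<Rightarrow> motzkin k"
      and g = "\<lambda>c n. card (interval_lists
        (\<lambda>xs. av132 xs \<and> dominant_initial_descent xs \<and> dominant_double_descents xs) c n)"])
  let ?P = "\<lambda>xs. av132 xs \<and> dominant_initial_descent xs \<and> dominant_double_descents xs"
  let ?Q = "\<lambda>xs. av132 xs \<and> no_double_descent xs \<and> no_initial_descent xs"
  show "card (interval_lists ?P c (Suc n)) =
      (\<Sum>i\<le>n. (case i of 0 \<Rightarrow> 1 | Suc k \<Rightarrow> motzkin k) * card (interval_lists ?P c (n - i)))" for c n
  proof -
    have "card (interval_lists ?P c (Suc n)) =
        (\<Sum>i\<le>n. card (interval_lists ?Q (c + (n - i)) i) * card (interval_lists ?P c (n - i)))"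
      by (rule card_interval_lists_Suc)
        (auto simp: av132_split dominant_double_descents_split dominant_initial_descent_split)
    then show ?thesis unfolding card_no_descent_av132 .
  qed
qed (auto simp: card_interval_lists_0)

lemma card_dominant_double_descents_av132:
  "card (interval_lists (\<lambda>xs. av132 xs \<and> dominant_double_descents xs) c (Suc n)) =
    (\<Sum>i\<le>n. motzkin i * motzkin (n - i))"
proof -
  let ?Q = "\<lambda>xs. av132 xs \<and> no_double_descent xs"
  let ?S = "\<lambda>xs. av132 xs \<and> dominant_initial_descent xs \<and> dominant_double_descents xs"
  have "card (interval_lists (\<lambda>xs. av132 xs \<and> dominant_double_descents xs) c (Suc n)) =
      (\<Sum>i\<le>n. card (interval_lists ?Q (c + (n - i)) i) * card (interval_lists ?S c (n - i)))"
    by (rule card_interval_lists_Suc)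
      (auto simp: av132_split dominant_double_descents_split)
  then show ?thesis by (simp only: card_no_double_descent_av132 card_dominant_descents_av132)
qed

theorem theorem6p8:
  fixes n :: nat
  assumes "n \<ge> 1"
  shows "int (card (Sort n (SC [1, 2, 3]))) = int (motzkin (n + 1)) - int (motzkin n)"
proof -
  obtain k where n: "n = Suc k" using assms by (cases n) auto
  have interval: "{1..n} = {1..<1 + n}" by auto
  have "Sort n (SC [1, 2, 3]) =
      interval_lists (\<lambda>xs. av132 xs \<and> dominant_double_descents xs) 1 n"
    unfolding Sort_SC_123_eq perms_def permutations_of_set_def interval_lists_def interval by blast
  then have "card (Sort n (SC [1, 2, 3])) = (\<Sum>i\<le>k. motzkin i * motzkin (k - i))"
    unfolding n by (simp only: card_dominant_double_descents_av132)
  \<comment> \<open>As \<open>n = Suc k\<close>, this convolution is exactly what the recurrence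
    adds to \<open>motzkin n\<close> to obtain \<open>motzkin (n + 1)\<close>.\<close>
  then show ?thesis using n by simp
qed

end
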